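(* Let $A$ be a selfadjoint (possibly unbounded) linear operator in a complex Hilbert space $H$ with null space $N$. Let $f\in H$ and let $y$ in the domain of $A$ satisfy $Ay=f$ and $y\perp N$. Let $a:[0,\infty)\to(0,\infty)$ be a continuous, differentiable function decaying monotonically to $0$ as $t\to\infty$ and such that $$a'+a^2\in L^1(0,\infty),\qquad \int_0^\infty a(s)\,ds=\infty .$$ Let $u(t)$, $t\ge0$, be the solution of $$\dot u=i(A+ia(t))u-if,\qquad u(0)=0 .$$ Then $$\lim_{t\to\infty}\|u(t)-y\|=0 .$$
   Context: $N=N(A)=\{u: Au=0\}$ is the null space of $A$; $\dot u=du/dt$; $A+ia(t)$ means $A+ia(t)I$ with $I$ the identity. Selfadjoint operators are densely defined and closed. The solution of the Cauchy problem is $u(t)=\int_0^t e^{iA(t-s)-\int_s^t a(p)\,dp}(-if)\,ds$. *)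

theory Defs
  imports "HOL-Analysis.Analysis"
begin

text \<open>
  Complex inner product spaces are built on top of the library class \<open>real_inner\<close>: the real
  structure is the one underlying the complex structure, and the real inner product is the real
  part of the complex one.  Hence \<open>norm x = sqrt (Re (cinner x x))\<close>, and limits, derivatives and
  completeness are the library notions.  The form is linear in the first argument and
  conjugate-linear in the second.
\<close>

class complex_inner = real_inner +
  fixes scaleC :: "complex \<Rightarrow> 'a \<Rightarrow> 'a" (infixr "*\<^sub>C" 75)
    and cinner :: "'a \<Rightarrow> 'a \<Rightarrow> complex"
  assumes scaleC_add_right: "c *\<^sub>C (x + y) = c *\<^sub>C x + c *\<^sub>C y"
    and scaleC_add_left: "(c + d) *\<^sub>C x = c *\<^sub>C x + d *\<^sub>C x"
    and scaleC_scaleC: "c *\<^sub>C d *\<^sub>C x = (c * d) *\<^sub>C x"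
    and scaleR_scaleC: "r *\<^sub>R x = complex_of_real r *\<^sub>C x"
    and cinner_commute: "cinner x y = cnj (cinner y x)"
    and cinner_add_left: "cinner (x + y) z = cinner x z + cinner y z"
    and cinner_scaleC_left: "cinner (c *\<^sub>C x) y = c * cinner x y"
    and inner_eq_Re_cinner: "inner x y = Re (cinner x y)"

class complex_hilbert_space = complex_inner + complete_space

instantiation complex :: complex_hilbert_space
begin

definition scaleC_complex :: "complex \<Rightarrow> complex \<Rightarrow> complex"
  where "scaleC_complex c x = c * x"

definition cinner_complex :: "complex \<Rightarrow> complex \<Rightarrow> complex"
  where "cinner_complex x y = x * cnj y"

instance
  by standard (auto simp: scaleC_complex_def cinner_complex_def algebra_simps
      scaleR_conv_of_real inner_complex_def)

end

text \<open>
  An unbounded operator is a pair of its domain \<open>D\<close> and a function \<open>A\<close>, of which only the values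
  on \<open>D\<close> are relevant.
\<close>

definition linear_operator :: "'a::complex_inner set \<Rightarrow> ('a \<Rightarrow> 'a) \<Rightarrow> bool" where
  "linear_operator D A \<longleftrightarrow>
     0 \<in> D \<and>
     (\<forall>x\<in>D. \<forall>y\<in>D. x + y \<in> D \<and> A (x + y) = A x + A y) \<and>
     (\<forall>c. \<forall>x\<in>D. c *\<^sub>C x \<in> D \<and> A (c *\<^sub>C x) = c *\<^sub>C A x)"

definition adjoint_domain :: "'a::complex_inner set \<Rightarrow> ('a \<Rightarrow> 'a) \<Rightarrow> 'a set" where
  "adjoint_domain D A = {v. \<exists>w. \<forall>x\<in>D. cinner (A x) v = cinner x w}"

text \<open>The vector described is unique when \<open>D\<close> is dense.\<close>

definition adjoint_operator :: "'a::complex_inner set \<Rightarrow> ('a \<Rightarrow> 'a) \<Rightarrow> 'a \<Rightarrow> 'a" where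
  "adjoint_operator D A v = (THE w. \<forall>x\<in>D. cinner (A x) v = cinner x w)"

text \<open>Closedness is not listed below: it follows, since adjoints are closed.\<close>

definition selfadjoint_operator :: "'a::complex_inner set \<Rightarrow> ('a \<Rightarrow> 'a) \<Rightarrow> bool" where
  "selfadjoint_operator D A \<longleftrightarrow>
     linear_operator D A \<and> closure D = UNIV \<and>
     adjoint_domain D A = D \<and> (\<forall>v\<in>D. adjoint_operator D A v = A v)"

definition null_space :: "'a::complex_inner set \<Rightarrow> ('a \<Rightarrow> 'a) \<Rightarrow> 'a set" where
  "null_space D A = {x \<in> D. A x = 0}"

text \<open>
  Solution on \<open>[0, \<infinity>)\<close> of \<open>u' = i (A + i a(t)) u - i f\<close>, \<open>u(0) = 0\<close>, with norm
  derivative (one-sided at \<open>0\<close>).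
\<close>

definition cauchy_solution ::
  "'a::complex_inner set \<Rightarrow> ('a \<Rightarrow> 'a) \<Rightarrow> (real \<Rightarrow> real) \<Rightarrow> 'a \<Rightarrow> (real \<Rightarrow> 'a) \<Rightarrow> bool" where
  "cauchy_solution D A a f u \<longleftrightarrow>
     u 0 = 0 \<and>
     (\<forall>t\<ge>0. u t \<in> D \<and>
       (u has_vector_derivative
          \<i> *\<^sub>C (A (u t) + (\<i> * complex_of_real (a t)) *\<^sub>C u t) - \<i> *\<^sub>C f)
         (at t within {0..}))"

end

theory Submission
  imports Defs
begin

text \<open>
  Write \<open>h = a' + a\<^sup>2\<close>.  The error \<open>v = u - y\<close> satisfies \<open>v' = i A v - a v - a y\<close>.  The first
  term does not change the norm because \<open>A\<close> is symmetric, the second one damps, and the source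
  \<open>- a y\<close> is of the same order as the damping, so that a plain energy estimate only shows that
  \<open>v\<close> stays bounded.  To gain more, \<open>y \<perp> N\<close> is used: as \<open>A\<close> is selfadjoint, the orthogonal
  complement of its range is \<open>N\<close>, so \<open>y\<close> lies in the closure of the range
  (\<open>orthogonal_null_space_in_closure_range\<close>), and \<open>y = A w + \<rho>\<close> with \<open>w\<close> in the
  domain and \<open>\<parallel>\<rho>\<parallel>\<close> as small as desired.

  A source \<open>- a A w\<close> can be absorbed by an explicit corrector: \<open>z = - i a w\<close> solves
  \<open>z' = i A z - a z - a A w - i h w\<close>, and \<open>z \<rightarrow> 0\<close> because \<open>a \<rightarrow> 0\<close>.  This computation is what
  brings in the combination \<open>a' + a\<^sup>2\<close>.  Therefore \<open>r = v - z = u - y + i a w\<close> satisfies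
  \<open>r' = i A r - a r - a \<rho> + i h w\<close> (\<open>corrected_error_derivative\<close>).

  Let \<open>F' = a\<close>.  The energy estimate for \<open>r\<close> on \<open>[T, t]\<close> (\<open>dissipative_bound\<close>) is
  \<open>\<parallel>r(t)\<parallel> \<le> exp (F(T) - F(t)) (1 + \<parallel>r(T)\<parallel>) + \<parallel>\<rho>\<parallel> + \<parallel>w\<parallel> \<integral>\<^sub>T\<^sup>t \<bar>h\<bar>\<close>.  The last term is small for all
  \<open>t\<close> once \<open>T\<close> is large, because \<open>h\<close> is integrable, and for fixed \<open>T\<close> the first one tends to \<open>0\<close>
  as \<open>t \<rightarrow> \<infinity>\<close>, because \<open>F \<rightarrow> \<infinity>\<close>.
\<close>

section \<open>Complex scalars, dense domains and linear operators\<close>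

lemma scaleC_zero_right: "c *\<^sub>C 0 = (0::'a::complex_inner)"
  using scaleC_add_right[of c 0 0] by simp

lemma scaleC_minus_right: "c *\<^sub>C (- x) = - (c *\<^sub>C (x::'a::complex_inner))"
  using scaleC_add_right[of c x "- x"]
  by (simp add: scaleC_zero_right eq_neg_iff_add_eq_0 add.commute)

lemma scaleC_diff_right: "c *\<^sub>C (x - y) = c *\<^sub>C x - c *\<^sub>C (y::'a::complex_inner)"
  using scaleC_add_right[of c x "- y"] by (simp add: scaleC_minus_right)

lemma scaleC_scaleR: "c *\<^sub>C (r *\<^sub>R x) = r *\<^sub>R (c *\<^sub>C (x::'a::complex_inner))"
  by (simp add: scaleR_scaleC scaleC_scaleC mult.commute)

lemma ii_scaleC_ii: "\<i> *\<^sub>C \<i> *\<^sub>C x = - (x::'a::complex_inner)"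
proof -
  have "\<i> *\<^sub>C \<i> *\<^sub>C x = complex_of_real (-1) *\<^sub>C x" by (simp add: scaleC_scaleC)
  also have "\<dots> = (-1) *\<^sub>R x" by (rule scaleR_scaleC[symmetric])
  finally show ?thesis by simp
qed

lemma cinner_zero_right: "cinner x 0 = (0::complex)" for x :: "'a::complex_inner"
proof -
  have "cinner 0 x = 0" using cinner_add_left[of 0 0 x] by simp
  then show ?thesis by (subst cinner_commute) simp
qed

lemma inner_eq_0_on_closure:
  fixes q :: "'a::real_inner"
  assumes "\<And>x. x \<in> D \<Longrightarrow> inner x q = 0" "z \<in> closure D"
  shows "inner z q = 0"
proof -
  have "closed {x. inner x q = 0}" by (intro closed_Collect_eq continuous_intros)
  then have "closure D \<subseteq> {x. inner x q = 0}" using assms(1) by (intro closure_minimal) auto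
  then show ?thesis using assms(2) by blast
qed

lemma linear_operator_rules:
  fixes D :: "'a::complex_inner set"
  assumes "linear_operator D A"
  shows "subspace D" "\<And>x c. x \<in> D \<Longrightarrow> A (c *\<^sub>R x) = c *\<^sub>R A x"
    "\<And>x y. x \<in> D \<Longrightarrow> y \<in> D \<Longrightarrow> A (x + y) = A x + A y"
    "\<And>x y. x \<in> D \<Longrightarrow> y \<in> D \<Longrightarrow> A (x - y) = A x - A y"
    "\<And>x c. x \<in> D \<Longrightarrow> c *\<^sub>C x \<in> D \<and> A (c *\<^sub>C x) = c *\<^sub>C A x"
proof -
  have add: "x + y \<in> D \<and> A (x + y) = A x + A y" if "x \<in> D" "y \<in> D" for x y
    using assms that by (simp add: linear_operator_def)
  show scC: "c *\<^sub>C x \<in> D \<and> A (c *\<^sub>C x) = c *\<^sub>C A x" if "x \<in> D" for x c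
    using assms that by (simp add: linear_operator_def)
  have "0 \<in> D" using assms by (simp add: linear_operator_def)
  then show sub: "subspace D"
    by (intro subspaceI) (simp_all add: scaleR_scaleC add scC)
  show sc: "A (c *\<^sub>R x) = c *\<^sub>R A x" if "x \<in> D" for x c
    by (simp add: scaleR_scaleC scC that)
  show "A (x + y) = A x + A y" if "x \<in> D" "y \<in> D" for x y
    using add that by blast
  show "A (x - y) = A x - A y" if "x \<in> D" "y \<in> D" for x y
    using add[OF that(1), of "(-1) *\<^sub>R y"] sc[OF that(2), of "-1"] subspace_neg[OF sub that(2)] by simp
qed

section \<open>The closure of the range of a selfadjoint operator\<close>

lemma adjoint_operator_unique:
  fixes D :: "'a::complex_inner set"
  assumes "closure D = UNIV" "\<forall>x\<in>D. cinner (A x) v = cinner x w"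
  shows "adjoint_operator D A v = w"
  unfolding adjoint_operator_def
proof (rule the_equality)
  fix w' assume "\<forall>x\<in>D. cinner (A x) v = cinner x w'"
  then have "inner x w' = inner x w" if "x \<in> D" for x
    using that assms(2) by (simp add: inner_eq_Re_cinner)
  then have "inner x (w' - w) = 0" if "x \<in> D" for x
    using that by (simp add: inner_diff_right)
  then have "inner (w' - w) (w' - w) = 0"
    using inner_eq_0_on_closure[of D "w' - w" "w' - w"] assms(1) by simp
  then show "w' = w" by simp
qed (rule assms)

lemma selfadjoint_symmetric:
  fixes D :: "'a::complex_inner set"
  assumes "selfadjoint_operator D A" "x \<in> D" "v \<in> D"
  shows "cinner (A x) v = cinner x (A v)"
proof -
  have D: "closure D = UNIV" "v \<in> adjoint_domain D A" "adjoint_operator D A v = A v"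
    using assms by (auto simp: selfadjoint_operator_def)
  then obtain w where w: "\<forall>x\<in>D. cinner (A x) v = cinner x w"
    by (auto simp: adjoint_domain_def)
  show ?thesis using w adjoint_operator_unique[OF D(1) w] D(3) assms(2) by simp
qed

text \<open>
  This removes the unbounded term from the energy balance: the quadratic form of a symmetric
  operator is real, so \<open>i A x\<close> is orthogonal to \<open>x\<close> for the real inner product.
\<close>

lemma selfadjoint_inner_ii:
  fixes D :: "'a::complex_inner set"
  assumes "selfadjoint_operator D A" "x \<in> D"
  shows "inner x (\<i> *\<^sub>C A x) = 0"
proof -
  have "cinner (A x) x = cnj (cinner (A x) x)"
    by (rule trans[OF selfadjoint_symmetric[OF assms assms(2)] cinner_commute])
  then have "Im (cinner (A x) x) = Im (cnj (cinner (A x) x))" by (rule arg_cong)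
  then have "Im (cinner (A x) x) = 0" by simp
  then show ?thesis
    by (subst inner_commute) (simp add: inner_eq_Re_cinner cinner_scaleC_left)
qed

text \<open>
  Orthogonality to the range says that \<open>0\<close> represents \<open>x \<mapsto> \<langle>A x, q\<rangle>\<close>, so that \<open>q\<close> is in the domain
  of the adjoint, which is \<open>A\<close> itself, and \<open>A q = 0\<close>.  Real orthogonality is enough, as the range
  is closed under multiplication by \<open>i\<close>.
\<close>

lemma orthogonal_range_null_space:
  fixes D :: "'a::complex_inner set"
  assumes sa: "selfadjoint_operator D A" and orth: "\<And>x. x \<in> D \<Longrightarrow> inner (A x) q = 0"
  shows "q \<in> null_space D A"
proof -
  have lin: "linear_operator D A" and D: "closure D = UNIV" "adjoint_domain D A = D"
      "\<forall>v\<in>D. adjoint_operator D A v = A v"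
    using sa by (simp_all add: selfadjoint_operator_def)
  have "cinner (A x) q = 0" if "x \<in> D" for x
  proof -
    have "\<i> *\<^sub>C x \<in> D" "A (\<i> *\<^sub>C x) = \<i> *\<^sub>C A x"
      using lin that by (simp_all add: linear_operator_def)
    then have "Re (\<i> * cinner (A x) q) = 0"
      using orth[of "\<i> *\<^sub>C x"] by (simp only: inner_eq_Re_cinner cinner_scaleC_left)
    moreover have "Re (cinner (A x) q) = 0"
      using orth[OF that] by (simp add: inner_eq_Re_cinner)
    ultimately show ?thesis by (simp add: complex_eq_iff)
  qed
  then have *: "\<forall>x\<in>D. cinner (A x) q = cinner x 0" by (simp add: cinner_zero_right)
  then have "q \<in> D" using D(2) by (auto simp: adjoint_domain_def)
  moreover have "A q = 0" using adjoint_operator_unique[OF D(1) *] D(3) \<open>q \<in> D\<close> by simp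
  ultimately show ?thesis by (simp add: null_space_def)
qed

lemma subspace_closure_of:
  fixes S :: "'a::real_normed_vector set"
  assumes "subspace S" shows "subspace (closure S)"
proof (rule subspaceI)
  show "0 \<in> closure S" by (rule subsetD[OF closure_subset subspace_0[OF assms]])
  show "x + y \<in> closure S" if "x \<in> closure S" "y \<in> closure S" for x y
  proof -
    obtain f g where "\<forall>n::nat. f n \<in> S" "f \<longlonglongrightarrow> x" "\<forall>n::nat. g n \<in> S" "g \<longlonglongrightarrow> y"
      using \<open>x \<in> _\<close> \<open>y \<in> _\<close> unfolding closure_sequential by blast
    then show ?thesis unfolding closure_sequential
      by (intro exI[of _ "\<lambda>n. f n + g n"]) (auto intro!: tendsto_add subspace_add assms)
  qed
  show "c *\<^sub>R x \<in> closure S" if "x \<in> closure S" for x c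
  proof -
    obtain f where "\<forall>n::nat. f n \<in> S" "f \<longlonglongrightarrow> x"
      using \<open>x \<in> closure S\<close> closure_sequential[of x S] by blast
    then show ?thesis unfolding closure_sequential
      by (intro exI[of _ "\<lambda>n. c *\<^sub>R f n"]) (auto intro!: tendsto_intros subspace_scale assms)
  qed
qed

text \<open>
  A sequence in \<open>C\<close> whose distances to \<open>y\<close> approach the infimum is Cauchy by the parallelogram law.
  Its limit is a nearest point of \<open>C\<close>, and moving it along a direction \<open>x\<close> in \<open>C\<close> cannot decrease
  the distance, which forces the residual to be orthogonal to \<open>x\<close>.
\<close>

lemma orthogonal_projection_exists:
  fixes C :: "'a::{real_inner,complete_space} set"
  assumes "subspace C" "closed C"
  obtains p where "p \<in> C" "\<And>x. x \<in> C \<Longrightarrow> inner (y - p) x = 0"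
proof -
  define d where "d = infdist y C"
  have C0: "0 \<in> C" using assms subspace_0 by blast
  have d0: "d \<ge> 0" by (simp add: d_def infdist_nonneg)
  have low: "d\<^sup>2 \<le> (norm (y - x))\<^sup>2" if "x \<in> C" for x
    using infdist_le[OF that, of y] d0 by (simp add: d_def dist_norm)
  have "\<exists>x\<in>C. (norm (y - x))\<^sup>2 < d\<^sup>2 + e" if "e > 0" for e
  proof -
    have "d < sqrt (d\<^sup>2 + e)"
      using that by (simp add: real_less_rsqrt)
    moreover have "C \<noteq> {}" using C0 by blast
    ultimately obtain x where "x \<in> C" "dist y x < sqrt (d\<^sup>2 + e)"
      using cINF_less_iff[of C "dist y" "sqrt (d\<^sup>2 + e)"] by (auto simp: d_def infdist_notempty)
    then have "(norm (y - x))\<^sup>2 < (sqrt (d\<^sup>2 + e))\<^sup>2"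
      by (intro power_strict_mono) (auto simp: dist_norm)
    then show ?thesis using \<open>x \<in> C\<close> that d0 by (auto intro!: bexI[of _ x])
  qed
  then have "\<forall>n. \<exists>x\<in>C. (norm (y - x))\<^sup>2 < d\<^sup>2 + inverse (real (Suc n))"
    by simp
  then obtain s where s: "\<And>n. s n \<in> C"
      "\<And>n. (norm (y - s n))\<^sup>2 < d\<^sup>2 + inverse (real (Suc n))"
    by metis
  have par: "(norm (s m - s n))\<^sup>2 \<le> 2 * inverse (real (Suc m)) + 2 * inverse (real (Suc n))"
    for m n
  proof -
    let ?h = "(1/2) *\<^sub>R (s m + s n)"
    have "?h \<in> C" using assms(1) s(1) by (intro subspace_scale subspace_add)
    then have "d\<^sup>2 \<le> (norm (y - ?h))\<^sup>2" by (rule low)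
    moreover have "(norm (s m - s n))\<^sup>2
        = 2 * (norm (y - s m))\<^sup>2 + 2 * (norm (y - s n))\<^sup>2 - 4 * (norm (y - ?h))\<^sup>2"
      by (simp add: power2_norm_eq_inner inner_diff_left inner_diff_right inner_add_left
          inner_add_right inner_commute algebra_simps)
    ultimately show ?thesis using s(2)[of m] s(2)[of n] by linarith
  qed
  have "Cauchy s"
  proof (rule metric_CauchyI)
    fix e :: real assume "e > 0"
    then obtain M where M: "inverse (real (Suc M)) < e\<^sup>2 / 4"
      using reals_Archimedean[of "e\<^sup>2 / 4"] by auto
    have "dist (s m) (s n) < e" if "m \<ge> M" "n \<ge> M" for m n
    proof -
      have inv: "inverse (real (Suc k)) \<le> inverse (real (Suc M))" if "k \<ge> M" for k
        using that by (intro le_imp_inverse_le) auto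
      then have "(norm (s m - s n))\<^sup>2 < e\<^sup>2"
        using par[of m n] inv[OF that(1)] inv[OF that(2)] M by linarith
      then show ?thesis using \<open>e > 0\<close> by (simp add: dist_norm power2_less_imp_less)
    qed
    then show "\<exists>M. \<forall>m\<ge>M. \<forall>n\<ge>M. dist (s m) (s n) < e" by blast
  qed
  then obtain p where p: "s \<longlonglongrightarrow> p"
    using Cauchy_convergent convergent_def by blast
  have pC: "p \<in> C" using closed_sequentially[OF assms(2)] s(1) p by blast
  have "(norm (y - p))\<^sup>2 \<le> d\<^sup>2"
  proof (rule LIMSEQ_le)
    show "(\<lambda>n. (norm (y - s n))\<^sup>2) \<longlonglongrightarrow> (norm (y - p))\<^sup>2"
      by (intro tendsto_intros p)
    show "(\<lambda>n. d\<^sup>2 + inverse (real (Suc n))) \<longlonglongrightarrow> d\<^sup>2"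
      using LIMSEQ_inverse_real_of_nat_add[of "d\<^sup>2"] by simp
    show "\<exists>N. \<forall>n\<ge>N. (norm (y - s n))\<^sup>2 \<le> d\<^sup>2 + inverse (real (Suc n))"
      using s(2) less_imp_le by blast
  qed
  moreover have "inner (y - p) x = 0" if "x \<in> C" and min: "(norm (y - p))\<^sup>2 \<le> d\<^sup>2" for x
  proof (cases "x = 0")
    case False
    \<comment> \<open>The multiple of \<open>x\<close> that is best for approximating \<open>y - p\<close>.\<close>
    define c where "c = inner (y - p) x / (norm x)\<^sup>2"
    have "p + c *\<^sub>R x \<in> C" using assms(1) pC that by (intro subspace_scale subspace_add)
    then have "(norm (y - p))\<^sup>2 \<le> (norm (y - (p + c *\<^sub>R x)))\<^sup>2" using low[of "p + c *\<^sub>R x"] min by linarith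
    also have "\<dots> = (norm (y - p))\<^sup>2 - 2 * c * inner (y - p) x + c\<^sup>2 * (norm x)\<^sup>2"
      unfolding diff_diff_eq[symmetric] power2_norm_eq_inner
      by (simp add: inner_diff_left inner_diff_right inner_commute algebra_simps power2_eq_square)
    also have "\<dots> = (norm (y - p))\<^sup>2 - (inner (y - p) x)\<^sup>2 / (norm x)\<^sup>2"
      using False by (simp add: c_def power2_eq_square)
    finally have "(inner (y - p) x)\<^sup>2 / (norm x)\<^sup>2 \<le> 0" by simp
    then show ?thesis using False by (simp add: divide_le_0_iff)
  qed simp
  ultimately show thesis using that pC by blast
qed

text \<open>
  The residual of the projection of \<open>y\<close> onto the closed range is orthogonal to the range, hence
  lies in the null space, hence is orthogonal to \<open>y\<close> as well as to the projection.
\<close>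

lemma orthogonal_null_space_in_closure_range:
  fixes D :: "'a::complex_hilbert_space set"
  assumes sa: "selfadjoint_operator D A"
    and orth: "\<forall>z\<in>null_space D A. cinner y z = 0"
  shows "y \<in> closure (A ` D)"
proof -
  have lin: "linear_operator D A" using sa by (simp add: selfadjoint_operator_def)
  note L = linear_operator_rules[OF lin]
  have "subspace (A ` D)"
  proof (rule subspaceI)
    show "0 \<in> A ` D" using L(2)[of 0 0] subspace_0[OF L(1)] by force
    fix u v c assume "u \<in> A ` D"
    then obtain x where x: "u = A x" "x \<in> D" by blast
    have "c *\<^sub>R u = A (c *\<^sub>R x)" using x L(2) by simp
    then show "c *\<^sub>R u \<in> A ` D" using subspace_scale[OF L(1) x(2)] by blast
    assume "v \<in> A ` D"
    then obtain z where z: "v = A z" "z \<in> D" by blast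
    have "u + v = A (x + z)" using x z L(3) by simp
    then show "u + v \<in> A ` D" using subspace_add[OF L(1) x(2) z(2)] by blast
  qed
  then obtain p where p: "p \<in> closure (A ` D)"
      "\<And>x. x \<in> closure (A ` D) \<Longrightarrow> inner (y - p) x = 0"
    using orthogonal_projection_exists[OF subspace_closure_of[OF \<open>subspace (A ` D)\<close>] closed_closure, of y]
    by blast
  have "y - p \<in> null_space D A"
  proof (rule orthogonal_range_null_space[OF sa])
    fix x assume "x \<in> D"
    then have "A x \<in> closure (A ` D)" by (intro subsetD[OF closure_subset] imageI)
    then show "inner (A x) (y - p) = 0" using p(2) by (simp add: inner_commute)
  qed
  then have "inner y (y - p) = 0" using orth by (simp add: inner_eq_Re_cinner)
  moreover have "inner p (y - p) = 0" using p by (simp add: inner_commute)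
  ultimately have "inner (y - p) (y - p) = 0" by (simp add: inner_diff_left)
  then show ?thesis using p(1) by simp
qed

section \<open>The damping and the perturbation coefficient\<close>

lemma integral_tail_small:
  fixes h :: "real \<Rightarrow> real"
  assumes "h absolutely_integrable_on {c<..}" "e > 0"
  obtains T where "T > c"
    "\<And>t. t \<ge> T \<Longrightarrow> (\<lambda>s. \<bar>h s\<bar>) integrable_on {T..t}"
    "\<And>t. t \<ge> T \<Longrightarrow> integral {T..t} (\<lambda>s. \<bar>h s\<bar>) < e"
proof -
  let ?g = "\<lambda>s. \<bar>h s\<bar>"
  define H where "H t = integral {c+1..t} ?g" for t
  have g: "?g integrable_on {c<..}"
    using assms(1) unfolding absolutely_integrable_on_def by simp
  have int: "?g integrable_on {a..b}" if "a > c" for a b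
    by (rule integrable_on_subinterval[OF g]) (use that in auto)
  have "H t \<le> integral {c<..} ?g" for t
    unfolding H_def by (intro integral_subset_le g int) auto
  then have bdd: "bdd_above (H ` {c+1..})" by (auto intro!: bdd_aboveI2)
  have "Sup (H ` {c+1..}) - e < Sup (H ` {c+1..})" using assms(2) by simp
  then obtain T where T: "T \<ge> c + 1" "Sup (H ` {c+1..}) - e < H T"
    by (subst (asm) less_cSUP_iff[OF _ bdd]) auto
  show thesis
  proof
    show "T > c" using T by simp
    then show "?g integrable_on {T..t}" for t by (rule int)
    fix t assume "t \<ge> T"
    then have "H t \<le> Sup (H ` {c+1..})" using T by (intro cSUP_upper bdd) auto
    moreover have "H T + integral {T..t} ?g = H t"
      unfolding H_def using \<open>t \<ge> T\<close> T int by (intro Henstock_Kurzweil_Integration.integral_combine) auto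
    ultimately show "integral {T..t} ?g < e" using T by simp
  qed
qed

lemma antiderivative_at_top:
  fixes a :: "real \<Rightarrow> real"
  assumes cont: "continuous_on {0..} a" and pos: "\<forall>t\<ge>0. a t > 0"
    and inf: "(\<integral>\<^sup>+s\<in>{0..}. ennreal (a s) \<partial>lborel) = \<infinity>"
  obtains F where "\<And>t. t \<ge> 0 \<Longrightarrow> (F has_real_derivative a t) (at t)"
    "filterlim F at_top at_top"
proof -
  \<comment> \<open>Extending \<open>a\<close> by a constant to the left gives an antiderivative that is differentiable
      from both sides at \<open>0\<close>.\<close>
  define b where "b t = a (max 0 t)" for t
  have contb: "continuous_on UNIV b" unfolding b_def
    by (rule continuous_on_compose2[OF cont]) (auto intro!: continuous_intros)
  then have "isCont b x" for x
    by (simp add: continuous_on_eq_continuous_at)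
  then have "\<exists>F. \<forall>x :: real. -\<infinity> < ereal x \<longrightarrow> ereal x < \<infinity> \<longrightarrow> (F has_vector_derivative b x) (at x)"
    by (intro einterval_antiderivative) auto
  then obtain F where F: "\<And>x. (F has_real_derivative b x) (at x)"
    by (auto simp: has_real_derivative_iff_has_vector_derivative)
  have b0: "b x \<ge> 0" for x using pos by (simp add: b_def less_imp_le)
  have mono: "mono F"
    by (rule monoI, rule DERIV_nonneg_imp_nondecreasing) (use F b0 in blast)+
  \<comment> \<open>A bounded monotone antiderivative would converge, making the integral finite.\<close>
  have unb: "\<exists>t. F t > B" for B
  proof (rule ccontr)
    assume "\<not> ?thesis"
    then have "bdd_above (range F)" by (auto intro!: bdd_aboveI2[of _ _ B] simp: not_less)
    then have "(F \<longlongrightarrow> (SUP t. F t)) at_top"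
    proof (intro increasing_tendsto)
      show "\<forall>\<^sub>F t in at_top. F t \<le> (SUP t. F t)"
        using \<open>bdd_above (range F)\<close> by (intro always_eventually allI cSUP_upper) auto
      fix z assume "z < (SUP t. F t)"
      then obtain t where "z < F t" using \<open>bdd_above (range F)\<close> by (auto simp: less_cSUP_iff)
      then have "z < F s" if "s \<ge> t" for s
        using monoD[OF mono that] by linarith
      then show "\<forall>\<^sub>F s in at_top. z < F s"
        unfolding eventually_at_top_linorder by blast
    qed
    then have "(\<integral>\<^sup>+x. ennreal (b x) * indicator {0..} x \<partial>lborel) = (SUP t. F t) - F 0"
      by (intro nn_integral_FTC_atLeast F b0 borel_measurable_continuous_onI contb)
    moreover have "(\<integral>\<^sup>+x. ennreal (b x) * indicator {0..} x \<partial>lborel)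
        = (\<integral>\<^sup>+s\<in>{0..}. ennreal (a s) \<partial>lborel)"
      by (intro nn_integral_cong) (auto simp: b_def indicator_def)
    ultimately show False using inf by simp
  qed
  show thesis
  proof
    show "(F has_real_derivative a t) (at t)" if "t \<ge> 0" for t
      using F[of t] that by (simp add: b_def)
    show "filterlim F at_top at_top"
      unfolding filterlim_at_top eventually_at_top_linorder
    proof
      fix Z obtain t where "F t > Z" using unb by blast
      then have "Z \<le> F n" if "n \<ge> t" for n
        using monoD[OF mono that] by linarith
      then show "\<exists>N. \<forall>n\<ge>N. Z \<le> F n" by blast
    qed
  qed
qed

section \<open>The energy estimate and the corrector\<close>

text \<open>
  Put \<open>G = exp (F - F(T))\<close> and \<open>\<Phi> = 1 + \<parallel>G r\<parallel>\<^sup>2\<close>.  The integrating factor \<open>G\<close> cancels the damping, and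
  \<open>(sqrt \<Phi>)' \<le> G (\<epsilon> a + g)\<close>.  Adding \<open>1\<close> keeps \<open>sqrt \<Phi>\<close> differentiable where \<open>r\<close> vanishes, and costs
  only the \<open>1\<close> in the decaying first term of the bound.  Here \<open>g\<close> is merely integrable and may be
  discontinuous, so \<open>sqrt \<Phi>\<close> is compared with integrals, through the Henstock--Kurzweil
  fundamental theorem, and not with an antiderivative of \<open>G (\<epsilon> a + g)\<close>.
\<close>

lemma dissipative_bound:
  fixes r r' :: "real \<Rightarrow> 'a::real_inner" and F a g :: "real \<Rightarrow> real"
  assumes "T \<le> t" "\<epsilon> \<ge> 0"
    and F: "\<And>s. s \<in> {T..t} \<Longrightarrow> (F has_real_derivative a s) (at s within {T..t})"
    and r: "\<And>s. s \<in> {T..t} \<Longrightarrow> (r has_vector_derivative r' s) (at s within {T..t})"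
    and diss: "\<And>s. s \<in> {T..t} \<Longrightarrow>
      inner (r s) (r' s) \<le> - a s * (norm (r s))\<^sup>2 + (\<epsilon> * a s + g s) * norm (r s)"
    and a0: "\<And>s. s \<in> {T..t} \<Longrightarrow> a s \<ge> 0" and g0: "\<And>s. s \<in> {T..t} \<Longrightarrow> g s \<ge> 0"
    and gint: "g integrable_on {T..t}"
  shows "norm (r t) \<le> exp (F T - F t) * (1 + norm (r T)) + \<epsilon> + integral {T..t} g"
proof -
  define G where "G s = exp (F s - F T)" for s
  define \<Phi> where "\<Phi> s = 1 + (G s)\<^sup>2 * inner (r s) (r s)" for s
  define \<Phi>' where "\<Phi>' s = 2 * (G s)\<^sup>2 * (a s * (norm (r s))\<^sup>2 + inner (r s) (r' s))" for s
  have G: "(G has_real_derivative G s * a s) (at s within {T..t})" if "s \<in> {T..t}" for s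
    unfolding G_def by (auto intro!: derivative_eq_intros F that)
  have \<Phi>: "(\<Phi> has_real_derivative \<Phi>' s) (at s within {T..t})" if "s \<in> {T..t}" for s
  proof -
    have r2: "((\<lambda>s. inner (r s) (r s)) has_real_derivative 2 * inner (r s) (r' s)) (at s within {T..t})"
      using has_derivative_inner[OF r[OF that, unfolded has_vector_derivative_def]
          r[OF that, unfolded has_vector_derivative_def]]
      by (simp add: has_field_derivative_def inner_commute mult.commute algebra_simps
          mult_commute_abs)
    have G2: "((\<lambda>s. (G s)\<^sup>2) has_real_derivative 2 * (G s)\<^sup>2 * a s) (at s within {T..t})"
      using G[OF that] by (auto intro!: derivative_eq_intros simp: power2_eq_square)
    show ?thesis unfolding \<Phi>_def \<Phi>'_def
      by (rule DERIV_cong[OF DERIV_add[OF DERIV_const DERIV_mult[OF G2 r2]]])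
        (simp add: algebra_simps dot_square_norm)
  qed
  have \<Phi>1: "\<Phi> s \<ge> 1" for s unfolding \<Phi>_def by simp
  have Gr: "G s * norm (r s) \<le> sqrt (\<Phi> s)" for s
    by (rule real_le_rsqrt) (simp add: \<Phi>_def power_mult_distrib power2_norm_eq_inner)
  have sqrt: "((\<lambda>s. sqrt (\<Phi> s)) has_real_derivative \<Phi>' s / (2 * sqrt (\<Phi> s))) (at s within {T..t})"
    if "s \<in> {T..t}" for s
    using \<Phi>[OF that] \<Phi>1[of s]
    by (auto intro!: derivative_eq_intros simp: field_simps)
  have Gmono: "G s \<le> G t" if "s \<in> {T..t}" for s
  proof -
    have "(F has_real_derivative a x) (at x within {s..t})" if "x \<in> {s..t}" for x
      by (rule DERIV_subset[OF F]) (use that \<open>s \<in> {T..t}\<close> in auto)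
    then have "(a has_integral F t - F s) {s..t}"
      using that by (intro fundamental_theorem_of_calculus)
        (auto simp flip: has_real_derivative_iff_has_vector_derivative)
    then have "F s \<le> F t"
      using has_integral_nonneg[of a "F t - F s" "{s..t}"] a0 that by force
    then show ?thesis by (simp add: G_def)
  qed
  have le: "\<Phi>' s / (2 * sqrt (\<Phi> s)) \<le> \<epsilon> * (G s * a s) + G t * g s" if s: "s \<in> {T..t}" for s
  proof -
    have "\<Phi>' s \<le> 2 * (G s)\<^sup>2 * ((\<epsilon> * a s + g s) * norm (r s))"
      unfolding \<Phi>'_def using diss[OF s] by (intro mult_left_mono) auto
    also have "\<dots> = 2 * (G s * (\<epsilon> * a s + g s)) * (G s * norm (r s))"
      by (simp add: power2_eq_square)
    also have "\<dots> \<le> 2 * (G s * (\<epsilon> * a s + g s)) * sqrt (\<Phi> s)"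
      using a0[OF s] g0[OF s] assms(2) by (intro mult_left_mono Gr) (auto simp: G_def)
    finally have "\<Phi>' s / (2 * sqrt (\<Phi> s)) \<le> G s * (\<epsilon> * a s + g s)"
      using \<Phi>1[of s] by (simp add: field_simps)
    also have "\<dots> \<le> \<epsilon> * (G s * a s) + G t * g s"
      using mult_right_mono[OF Gmono[OF s] g0[OF s]] by (simp add: algebra_simps)
    finally show ?thesis .
  qed
  have "sqrt (\<Phi> t) - sqrt (\<Phi> T) \<le> \<epsilon> * (G t - G T) + G t * integral {T..t} g"
  proof (rule has_integral_le)
    show "((\<lambda>s. \<Phi>' s / (2 * sqrt (\<Phi> s))) has_integral sqrt (\<Phi> t) - sqrt (\<Phi> T)) {T..t}"
      using sqrt assms(1)
      by (intro fundamental_theorem_of_calculus)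
        (auto simp: has_real_derivative_iff_has_vector_derivative)
    have "((\<lambda>s. G s * a s) has_integral G t - G T) {T..t}"
      using G assms(1)
      by (intro fundamental_theorem_of_calculus)
        (auto simp: has_real_derivative_iff_has_vector_derivative)
    then show "((\<lambda>s. \<epsilon> * (G s * a s) + G t * g s) has_integral
        \<epsilon> * (G t - G T) + G t * integral {T..t} g) {T..t}"
      using gint by (intro has_integral_add has_integral_mult_right integrable_integral)
  qed (rule le)
  moreover have "sqrt (\<Phi> T) \<le> 1 + norm (r T)"
    by (rule real_le_lsqrt)
      (auto simp: \<Phi>_def G_def power2_eq_square algebra_simps simp flip: power2_norm_eq_inner)
  moreover have "G T = 1" "G t > 0" by (simp_all add: G_def)
  ultimately have "G t * norm (r t) \<le> (1 + norm (r T)) + \<epsilon> * G t + G t * integral {T..t} g"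
    using Gr[of t] assms(2) by (simp add: algebra_simps)
  then have "norm (r t) \<le> ((1 + norm (r T)) + \<epsilon> * G t + G t * integral {T..t} g) / G t"
    using \<open>G t > 0\<close> by (simp add: pos_le_divide_eq mult.commute)
  also have "\<dots> = exp (F T - F t) * (1 + norm (r T)) + \<epsilon> + integral {T..t} g"
    using \<open>G t > 0\<close> by (simp add: G_def exp_diff field_simps)
  finally show ?thesis .
qed

text \<open>
  The corrector \<open>i a w\<close> is chosen such that \<open>A\<close> applied to it cancels the part \<open>a A w\<close> of the source
  \<open>a y\<close>; the derivative of \<open>a\<close> and the damping of the corrector leave the remainder
  \<open>i (a' + a\<^sup>2) w\<close>.
\<close>

lemma corrected_error_derivative:
  fixes D :: "'a::complex_inner set"
  assumes sa: "selfadjoint_operator D A" and y: "y \<in> D" "A y = f" and w: "w \<in> D"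
    and u: "u t \<in> D"
      "(u has_vector_derivative
          \<i> *\<^sub>C (A (u t) + (\<i> * complex_of_real (a t)) *\<^sub>C u t) - \<i> *\<^sub>C f) (at t within S)"
    and a: "(a has_real_derivative a' t) (at t within S)"
  defines "r \<equiv> \<lambda>t. u t - y + a t *\<^sub>R (\<i> *\<^sub>C w)"
  shows "r t \<in> D"
    "(r has_vector_derivative
       \<i> *\<^sub>C A (r t) - a t *\<^sub>R r t - a t *\<^sub>R (y - A w) + (a' t + (a t)\<^sup>2) *\<^sub>R (\<i> *\<^sub>C w)) (at t within S)"
proof -
  have lin: "linear_operator D A" using sa by (simp add: selfadjoint_operator_def)
  note L = linear_operator_rules[OF lin]
  have iw: "\<i> *\<^sub>C w \<in> D" "A (\<i> *\<^sub>C w) = \<i> *\<^sub>C A w" using L(5)[OF w] by auto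
  note D = subspace_add[OF L(1)] subspace_diff[OF L(1)] subspace_scale[OF L(1)]
  show "r t \<in> D" unfolding r_def using u(1) y iw(1) by (intro D)
  have Ar: "A (r t) = A (u t) - f + a t *\<^sub>R (\<i> *\<^sub>C A w)"
    unfolding r_def using u(1) y iw by (simp add: L D)
  have ia: "(\<i> * complex_of_real (a t)) *\<^sub>C u t = a t *\<^sub>R (\<i> *\<^sub>C u t)"
    by (simp add: scaleR_scaleC scaleC_scaleC mult.commute)
  have "(r has_vector_derivative
      \<i> *\<^sub>C (A (u t) + (\<i> * complex_of_real (a t)) *\<^sub>C u t) - \<i> *\<^sub>C f + a' t *\<^sub>R (\<i> *\<^sub>C w)) (at t within S)"
    unfolding r_def using u(2) a
    by (auto intro!: derivative_eq_intros)
  also have "\<i> *\<^sub>C (A (u t) + (\<i> * complex_of_real (a t)) *\<^sub>C u t) - \<i> *\<^sub>C f + a' t *\<^sub>R (\<i> *\<^sub>C w)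
     = \<i> *\<^sub>C A (r t) - a t *\<^sub>R r t - a t *\<^sub>R (y - A w) + (a' t + (a t)\<^sup>2) *\<^sub>R (\<i> *\<^sub>C w)"
    unfolding Ar ia unfolding r_def
    by (simp add: scaleC_add_right scaleC_diff_right scaleC_scaleR ii_scaleC_ii
        scaleR_left.add scaleR_add_right scaleR_diff_right scaleR_add_left power2_eq_square)
  finally show "(r has_vector_derivative
       \<i> *\<^sub>C A (r t) - a t *\<^sub>R r t - a t *\<^sub>R (y - A w) + (a' t + (a t)\<^sup>2) *\<^sub>R (\<i> *\<^sub>C w)) (at t within S)" .
qed

section \<open>Convergence of the solution\<close>

theorem theorem3:
  fixes D :: "'h::complex_hilbert_space set" and A :: "'h \<Rightarrow> 'h"
    and f y :: 'h and a a' :: "real \<Rightarrow> real" and u :: "real \<Rightarrow> 'h"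
  assumes "selfadjoint_operator D A"
    and "y \<in> D" and "A y = f"
    and "\<forall>z\<in>null_space D A. cinner y z = 0"
    and "\<forall>t\<ge>0. a t > 0"
    and "continuous_on {0..} a"
    and "\<forall>t\<ge>0. (a has_real_derivative a' t) (at t within {0..})"
    and "antimono_on {0..} a"
    and "(a \<longlongrightarrow> 0) at_top"
    and "(\<lambda>t. a' t + (a t)\<^sup>2) absolutely_integrable_on {0<..}"
    and "(\<integral>\<^sup>+s\<in>{0..}. ennreal (a s) \<partial>lborel) = \<infinity>"
    and "cauchy_solution D A a f u"
  shows "((\<lambda>t. norm (u t - y)) \<longlongrightarrow> 0) at_top"
proof (rule tendstoI)
  fix e :: real assume "e > 0"
  note sa = assms(1) and pos = assms(5) and der = assms(7)
  have sol: "u t \<in> D"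
    "(u has_vector_derivative
        \<i> *\<^sub>C (A (u t) + (\<i> * complex_of_real (a t)) *\<^sub>C u t) - \<i> *\<^sub>C f) (at t within {0..})"
    if "t \<ge> 0" for t
    using assms(12) that by (simp_all add: cauchy_solution_def)
  define h where "h t = a' t + (a t)\<^sup>2" for t
  have "y \<in> closure (A ` D)"
    by (rule orthogonal_null_space_in_closure_range[OF sa assms(4)])
  moreover have "e / 4 > 0" using \<open>e > 0\<close> by simp
  ultimately obtain w where w: "w \<in> D" "norm (y - A w) < e / 4"
    unfolding closure_approachable by (metis dist_norm norm_minus_commute imageE)
  define \<rho> where "\<rho> = y - A w"
  define W where "W = norm (\<i> *\<^sub>C w)"
  have W0: "W \<ge> 0" by (simp add: W_def)
  obtain F where F: "\<And>t. t \<ge> 0 \<Longrightarrow> (F has_real_derivative a t) (at t)"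
      and Finf: "filterlim F at_top at_top"
    using antiderivative_at_top[OF assms(6) pos assms(11)] by blast
  have "h absolutely_integrable_on {0<..}" using assms(10) unfolding h_def .
  \<comment> \<open>The summand \<open>1\<close> guards against \<open>w = 0\<close>.\<close>
  moreover have "e / (4 * (W + 1)) > 0" using \<open>e > 0\<close> W0 by simp
  ultimately obtain T where T: "T > 0"
      and hint: "\<And>t. t \<ge> T \<Longrightarrow> (\<lambda>s. \<bar>h s\<bar>) integrable_on {T..t}"
      and hsmall: "\<And>t. t \<ge> T \<Longrightarrow> integral {T..t} (\<lambda>s. \<bar>h s\<bar>) < e / (4 * (W + 1))"
    using integral_tail_small by blast
  define r where "r t = u t - y + a t *\<^sub>R (\<i> *\<^sub>C w)" for t
  define r' where "r' t = \<i> *\<^sub>C A (r t) - a t *\<^sub>R r t - a t *\<^sub>R \<rho> + h t *\<^sub>R (\<i> *\<^sub>C w)" for t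
  have rD: "r t \<in> D" and rder: "(r has_vector_derivative r' t) (at t within {0..})"
    if "t \<ge> 0" for t
  proof -
    have at: "(a has_real_derivative a' t) (at t within {0..})" using der that by blast
    note c = corrected_error_derivative[where u = u and a = a and a' = a' and t = t,
        OF sa assms(2,3) w(1) sol(1)[OF that] sol(2)[OF that] at]
    show "r t \<in> D" using c(1) by (simp only: r_def)
    show "(r has_vector_derivative r' t) (at t within {0..})"
      using c(2) unfolding r'_def h_def \<rho>_def r_def .
  qed
  have diss: "inner (r s) (r' s)
      \<le> - a s * (norm (r s))\<^sup>2 + (norm \<rho> * a s + W * \<bar>h s\<bar>) * norm (r s)" if "s \<ge> 0" for s
  proof -
    have "inner (r s) (r' s) = - a s * (norm (r s))\<^sup>2 - a s * inner (r s) \<rho>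
        + h s * inner (r s) (\<i> *\<^sub>C w)"
      unfolding r'_def
      by (simp add: inner_add_right inner_diff_right selfadjoint_inner_ii[OF sa rD[OF that]]
          dot_square_norm)
    moreover have "a s * (- inner (r s) \<rho>) \<le> a s * (norm (r s) * norm \<rho>)"
      using pos that Cauchy_Schwarz_ineq2[of "r s" \<rho>] by (intro mult_left_mono) (auto simp: less_imp_le)
    moreover have "h s * inner (r s) (\<i> *\<^sub>C w) \<le> \<bar>h s\<bar> * (norm (r s) * W)"
    proof -
      have "h s * inner (r s) (\<i> *\<^sub>C w) \<le> \<bar>h s\<bar> * \<bar>inner (r s) (\<i> *\<^sub>C w)\<bar>"
        by (metis abs_ge_self abs_mult)
      also have "\<dots> \<le> \<bar>h s\<bar> * (norm (r s) * W)"
        unfolding W_def by (intro mult_left_mono Cauchy_Schwarz_ineq2) simp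
      finally show ?thesis .
    qed
    ultimately show ?thesis by (simp add: algebra_simps)
  qed
  have bound: "norm (r t) < exp (F T - F t) * (1 + norm (r T)) + e / 2" if "t \<ge> T" for t
  proof -
    have "norm (r t) \<le> exp (F T - F t) * (1 + norm (r T)) + norm \<rho>
        + integral {T..t} (\<lambda>s. W * \<bar>h s\<bar>)"
    proof (rule dissipative_bound[where a = a and r' = r'])
      fix s assume "s \<in> {T..t}"
      then have s: "s \<ge> 0" using T by simp
      show "(F has_real_derivative a s) (at s within {T..t})"
        by (rule has_field_derivative_at_within[OF F[OF s]])
      show "(r has_vector_derivative r' s) (at s within {T..t})"
        by (rule has_vector_derivative_within_subset[OF rder[OF s]]) (use T in auto)
      show "inner (r s) (r' s)
          \<le> - a s * (norm (r s))\<^sup>2 + (norm \<rho> * a s + W * \<bar>h s\<bar>) * norm (r s)"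
        by (rule diss[OF s])
      show "a s \<ge> 0" using pos s by (simp add: less_imp_le)
      show "W * \<bar>h s\<bar> \<ge> 0" using W0 by simp
    next
      show "(\<lambda>s. W * \<bar>h s\<bar>) integrable_on {T..t}"
        using integrable_cmul[OF hint[OF that], of W] by simp
    qed (use that in auto)
    moreover have "integral {T..t} (\<lambda>s. W * \<bar>h s\<bar>) \<le> e / 4"
    proof -
      have "W * integral {T..t} (\<lambda>s. \<bar>h s\<bar>) \<le> W * (e / (4 * (W + 1)))"
        using hsmall[OF that] W0 by (intro mult_left_mono) auto
      also have "\<dots> \<le> e / 4" using W0 \<open>e > 0\<close> by (simp add: field_simps)
      finally show ?thesis by simp
    qed
    ultimately show ?thesis using w(2) by (simp add: \<rho>_def)
  qed
  have "((\<lambda>t. exp (F T - F t) * (1 + norm (r T))) \<longlongrightarrow> 0 * (1 + norm (r T))) at_top"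
  proof (intro tendsto_mult tendsto_const filterlim_compose[OF exp_at_bot])
    have "filterlim (\<lambda>t. - F T + F t) at_top at_top"
      by (rule filterlim_tendsto_add_at_top[OF tendsto_const Finf])
    then show "filterlim (\<lambda>t. F T - F t) at_bot at_top"
      by (simp add: filterlim_uminus_at_top)
  qed
  then have "\<forall>\<^sub>F t in at_top. exp (F T - F t) * (1 + norm (r T)) < e / 4"
    using \<open>e > 0\<close> by (intro order_tendstoD) auto
  moreover have "((\<lambda>t. a t * W) \<longlongrightarrow> 0 * W) at_top"
    by (intro tendsto_mult assms(9) tendsto_const)
  then have "\<forall>\<^sub>F t in at_top. a t * W < e / 4"
    using \<open>e > 0\<close> by (intro order_tendstoD) auto
  ultimately show "\<forall>\<^sub>F t in at_top. dist (norm (u t - y)) 0 < e"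
    using eventually_ge_at_top[of T]
  proof eventually_elim
    case (elim t)
    have "u t - y = r t - a t *\<^sub>R (\<i> *\<^sub>C w)" by (simp add: r_def)
    then have "norm (u t - y) \<le> norm (r t) + norm (a t *\<^sub>R (\<i> *\<^sub>C w))"
      by (simp only: norm_triangle_ineq4)
    also have "norm (a t *\<^sub>R (\<i> *\<^sub>C w)) = a t * W"
      using spec[OF pos, of t] T elim(3) by (simp add: W_def)
    finally show ?case using bound[OF elim(3)] elim by simp
  qed
qed

end
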